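(* Let $n\ge 1$, let $\kappa, m_1,\dots,m_n$ be positive integers, let $p>2$ be a prime with $p\nmid\kappa$, and let $M_a$ ($1\le a\le n$) and $M_{a,b}$ ($1\le a<b\le n$) be positive integers with $M_a\equiv -\frac{m_a}{\kappa}$ and $M_{a,b}\equiv\frac{m_am_b}{2\kappa}$ modulo $p$. Let $q$ be an integer, $l$ a positive integer, and let $I^{(lp-1)}(z,q)=(I_1(z),\dots,I_n(z))\in(\mathbb F_p[z_1,\dots,z_n])^n$ be the vector of polynomials defined in the context. Assume that $$M_1+\dots+M_n\equiv-1\pmod p.$$ Then, in $\mathbb F_p[z_1,\dots,z_n]$, $$z_1M_1I_1(z)+\dots+z_nM_nI_n(z)=0.$$
   Context: Notation: $z=(z_1,\dots,z_n)$. The congruences for $M_a,M_{a,b}$ are congruences after projecting $m_a,\kappa,2$ to $\mathbb F_p$ and computing the quotients in $\mathbb F_p$. Master polynomial: $\Phi^{(p)}(t,z)=\prod_{1\le a<b\le n}(z_a-z_b)^{M_{a,b}}\prod_{a=1}^n(t-z_a)^{M_a}$. For an integer $q$, expand in powers of $t-q$ $$\Phi^{(p)}(t,z)\Big(\frac1{t-z_1},\dots,\frac1{t-z_n}\Big)=\sum_i\bar I^{(i)}(z,q)\,(t-q)^i,$$ where $\bar I^{(i)}(z,q)$ are $n$-vectors of polynomials in $z$ with integer coefficients. $I^{(i)}(z,q)\in(\mathbb F_p[z])^n$ is the reduction of $\bar I^{(i)}(z,q)$ modulo $p$. (For $i=lp-1$ it is a solution of the KZ equations modulo $p$ with parameters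 $\kappa, m_1,\dots,m_n$.) *)

theory Defs
  imports "HOL-Library.Poly_Mapping" "HOL-Computational_Algebra.Polynomial"
    "HOL-Number_Theory.Cong" "Berlekamp_Zassenhaus.Finite_Field"
begin

text \<open>
  Polynomials in countably many variables, one for each natural number: a polynomial maps
  monomials (exponent vectors of finite support) to coefficients, with finite support. Only the
  variables with indices between 1 and n are used below; the polynomial ring in those n variables
  is a subring.
\<close>

type_synonym 'a mpoly = "(nat \<Rightarrow>\<^sub>0 nat) \<Rightarrow>\<^sub>0 'a"

definition Z :: "nat \<Rightarrow> 'a::comm_ring_1 mpoly" where
  "Z a = Poly_Mapping.single (Poly_Mapping.single a 1) 1"

text \<open>
  Polynomials in t and z are univariate polynomials in t whose coefficients are polynomials in z,
  so \<open>[:- Z a, 1:]\<close> is \<open>t - z\<^sub>a\<close>. The exponents \<open>M\<^sub>a\<close> and \<open>M\<^sub>a\<^sub>,\<^sub>b\<close> are given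
  by \<open>M a\<close> and \<open>N a b\<close>.
\<close>

definition master_poly :: "nat \<Rightarrow> (nat \<Rightarrow> nat) \<Rightarrow> (nat \<Rightarrow> nat \<Rightarrow> nat) \<Rightarrow> int mpoly poly" where
  "master_poly n M N =
     [:\<Prod>a\<in>{1..n}. \<Prod>b\<in>{a<..n}. (Z a - Z b) ^ N a b:] * (\<Prod>a\<in>{1..n}. [:- Z a, 1:] ^ M a)"

text \<open>
  The a-th coordinate \<open>\<Phi>\<^sup>(\<^sup>p\<^sup>)(t, z) / (t - z\<^sub>a)\<close> is a polynomial if \<open>1 \<le> a \<le> n\<close> and
  \<open>M a > 0\<close>; see \<open>master_quot_eq\<close>.
\<close>

definition master_quot ::
    "nat \<Rightarrow> (nat \<Rightarrow> nat) \<Rightarrow> (nat \<Rightarrow> nat \<Rightarrow> nat) \<Rightarrow> nat \<Rightarrow> int mpoly poly" where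
  "master_quot n M N a = (THE Q. [:- Z a, 1:] * Q = master_poly n M N)"

text \<open>
  The coefficient of \<open>(t - c) ^ i\<close> in the expansion of P in powers of \<open>t - c\<close>, read off from
  \<open>P(t + c)\<close>; see \<open>shifted_expansion\<close> and \<open>shifted_coeff_unique\<close>.
\<close>

definition shifted_coeff :: "'a::comm_ring_1 poly \<Rightarrow> 'a \<Rightarrow> nat \<Rightarrow> 'a" where
  "shifted_coeff P c i = coeff (pcompose P [:c, 1:]) i"

definition Ibar ::
    "nat \<Rightarrow> (nat \<Rightarrow> nat) \<Rightarrow> (nat \<Rightarrow> nat \<Rightarrow> nat) \<Rightarrow> int \<Rightarrow> nat \<Rightarrow> nat \<Rightarrow> int mpoly" where
  "Ibar n M N q i a = shifted_coeff (master_quot n M N a) (of_int q) i"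

definition reduce_mod :: "int mpoly \<Rightarrow> 'p::prime_card mod_ring mpoly" where
  "reduce_mod = Poly_Mapping.map of_int"

text \<open>The a-th coordinate of \<open>I\<^sup>(\<^sup>i\<^sup>)(z, q)\<close>; the prime p is the cardinality of \<open>'p\<close>.\<close>

definition Ivec ::
    "nat \<Rightarrow> (nat \<Rightarrow> nat) \<Rightarrow> (nat \<Rightarrow> nat \<Rightarrow> nat) \<Rightarrow> int \<Rightarrow> nat \<Rightarrow> nat
      \<Rightarrow> 'p::prime_card mod_ring mpoly" where
  "Ivec n M N q i a = reduce_mod (Ibar n M N q i a)"

lemma master_quot_eq:
  assumes "a \<in> {1..n}" "M a > 0"
  shows "[:- Z a, 1:] * master_quot n M N a = master_poly n M N"
proof -
  obtain k where k: "M a = Suc k" using assms(2) gr0_conv_Suc by auto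
  let ?c = "[:\<Prod>a\<in>{1..n}. \<Prod>b\<in>{a<..n}. (Z a - Z b :: int mpoly) ^ N a b:]"
  let ?Q = "?c * ([:- Z a, 1:] ^ k * (\<Prod>b\<in>{1..n} - {a}. [:- Z b, 1:] ^ M b))"
  have "master_poly n M N =
      ?c * ([:- Z a, 1:] ^ M a * (\<Prod>b\<in>{1..n} - {a}. [:- Z b, 1:] ^ M b))"
    unfolding master_poly_def using assms(1) by (subst prod.remove[of _ a]) simp_all
  also have "\<dots> = [:- Z a, 1:] * ?Q"
    unfolding k power_Suc by (simp only: mult_ac)
  finally have eq: "[:- Z a, 1:] * ?Q = master_poly n M N" by simp
  show ?thesis unfolding master_quot_def
  proof (rule theI)
    show "[:- Z a, 1:] * ?Q = master_poly n M N" by (fact eq)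
    fix Q assume "[:- Z a, 1:] * Q = master_poly n M N"
    then have "[:- Z a, 1:] * Q = [:- Z a, 1:] * ?Q" using eq by simp
    then show "Q = ?Q" by (subst (asm) mult_cancel_left) simp
  qed
qed

lemma shifted_expansion:
  "P = (\<Sum>i\<le>degree P. smult (shifted_coeff P c i) ([:- c, 1:] ^ i))"
proof -
  let ?R = "pcompose P [:c, 1:]"
  have pow: "pcompose (p ^ i) r = pcompose p r ^ i" for p r :: "'a poly" and i
    by (induction i) (simp_all add: pcompose_mult pcompose_1)
  have "degree ?R \<le> degree P"
    using degree_pcompose_le[of P "[:c, 1:]"] by simp
  then have R: "?R = (\<Sum>i\<le>degree P. smult (coeff ?R i) ([:0, 1:] ^ i))"
    using poly_as_sum_of_monoms'[of ?R "degree P"] by (simp add: monom_altdef)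
  have "P = pcompose ?R [:- c, 1:]"
    by (simp add: pcompose_assoc[symmetric] pcompose_pCons)
  also have "\<dots> = (\<Sum>i\<le>degree P. smult (coeff ?R i) ([:- c, 1:] ^ i))"
    by (subst R) (simp add: pcompose_sum pcompose_smult pow pcompose_pCons)
  finally show ?thesis unfolding shifted_coeff_def .
qed

lemma shifted_coeff_unique:
  assumes "P = (\<Sum>i\<le>d. smult (f i) ([:- c, 1:] ^ i))" "i \<le> d"
  shows "shifted_coeff P c i = f i"
proof -
  have pow: "pcompose (p ^ i) r = pcompose p r ^ i" for p r :: "'a poly" and i
    by (induction i) (simp_all add: pcompose_mult pcompose_1)
  have "pcompose P [:c, 1:] = (\<Sum>i\<le>d. monom (f i) i)"
    unfolding assms(1)
    by (simp add: pcompose_sum pcompose_smult pow pcompose_pCons monom_altdef)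
  then show ?thesis
    using assms(2) by (simp add: shifted_coeff_def coeff_sum)
qed

end

theory Submission
  imports Defs
begin

text \<open>
  Write \<open>\<Phi>\<close> for the master polynomial. Logarithmic differentiation gives
  \<open>\<Phi>' = \<Sum>\<^sub>a M\<^sub>a \<Phi> / (t - z\<^sub>a)\<close>, and \<open>z\<^sub>a = t - (t - z\<^sub>a)\<close> turns
  this into
  \<open>\<Sum>\<^sub>a z\<^sub>a M\<^sub>a \<Phi> / (t - z\<^sub>a) = t \<Phi>' - (\<Sum>\<^sub>a M\<^sub>a) \<Phi> = (t \<Phi>)' - (1 + \<Sum>\<^sub>a M\<^sub>a) \<Phi>\<close>.
  The last term vanishes modulo p by the assumption on the exponents, so that the left hand side
  is, modulo p, a derivative with respect to t. The coefficient of \<open>(t - q)\<^sup>i\<close> in a derivative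
  is divisible by \<open>i + 1\<close>, which is a multiple of p for \<open>i = l p - 1\<close>.

  The identity is proved with integer coefficients, in
  \<open>sum_Z_master_quot\<close>, and reduced modulo p only after the coefficient has been
  extracted; the reduction is a ring homomorphism whose kernel contains p.
\<close>

lemma lookup_reduce_mod: "Poly_Mapping.lookup (reduce_mod P) k = of_int (Poly_Mapping.lookup P k)"
  by (simp add: reduce_mod_def Poly_Mapping.map.rep_eq when_def)

lemma reduce_mod_0 [simp]: "reduce_mod 0 = 0"
  by (rule poly_mapping_eqI) (simp add: lookup_reduce_mod)

lemma reduce_mod_add: "reduce_mod (P + Q) = reduce_mod P + reduce_mod Q"
  by (rule poly_mapping_eqI) (simp add: lookup_reduce_mod lookup_add)

lemma reduce_mod_diff: "reduce_mod (P - Q) = reduce_mod P - reduce_mod Q"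
  by (rule poly_mapping_eqI) (simp add: lookup_reduce_mod lookup_minus)

lemma reduce_mod_sum: "reduce_mod (\<Sum>a\<in>A. f a) = (\<Sum>a\<in>A. reduce_mod (f a))"
  by (induction A rule: infinite_finite_induct) (simp_all add: reduce_mod_add)

lemma reduce_mod_single:
  "reduce_mod (Poly_Mapping.single k c) = Poly_Mapping.single k (of_int c)"
  by (rule poly_mapping_eqI) (simp add: lookup_reduce_mod lookup_single when_def)

text \<open>
  Adding one monomial at a time reduces statements that are additive in a polynomial, such as
  the multiplicativity of the reduction, to monomials.
\<close>

lemma poly_mapping_single_add_induct [case_names zero add]:
  fixes P :: "('a \<Rightarrow>\<^sub>0 'b::comm_monoid_add) \<Rightarrow> bool"
  assumes "P 0" and "\<And>k c f. P f \<Longrightarrow> P (Poly_Mapping.single k c + f)"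
  shows "P f"
proof (induction f rule: Poly_Mapping.update_induct)
  case const
  show ?case by (fact assms(1))
next
  case (update f k c)
  have "Poly_Mapping.update k c f = Poly_Mapping.single k c + f"
    using update(1)
    by (intro poly_mapping_eqI) (auto simp: lookup_update lookup_add lookup_single when_def in_keys_iff)
  then show ?case using assms(2)[OF update(3)] by simp
qed

lemma reduce_mod_mult: "reduce_mod (P * Q) = reduce_mod P * reduce_mod Q"
proof (induction P rule: poly_mapping_single_add_induct)
  case zero
  show ?case by simp
next
  case (add k c P)
  have "reduce_mod (Poly_Mapping.single k c * Q) =
      (reduce_mod (Poly_Mapping.single k c) * reduce_mod Q :: 'a mod_ring mpoly)"
    by (induction Q rule: poly_mapping_single_add_induct)
      (simp_all add: reduce_mod_single mult_single reduce_mod_add distrib_left)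
  then show ?case using add by (simp add: reduce_mod_add distrib_right)
qed

lemma reduce_mod_Z: "reduce_mod (Z a) = Z a"
  by (simp add: Z_def reduce_mod_single)

lemma reduce_mod_1: "reduce_mod 1 = 1"
  by (simp add: reduce_mod_single flip: single_one)

lemma reduce_mod_of_nat: "reduce_mod (of_nat k) = of_nat k"
  by (induction k) (simp_all add: reduce_mod_add reduce_mod_1)

lemma of_nat_card_mod_ring: "(of_nat CARD('p) :: 'p::prime_card mod_ring mpoly) = 0"
  by (metis of_nat_card_eq_0 single_of_nat single_zero)

lemma reduce_mod_of_nat_eq_0:
  assumes "CARD('p::prime_card) dvd k"
  shows "(reduce_mod (of_nat k) :: 'p mod_ring mpoly) = 0"
  unfolding reduce_mod_of_nat
  using assms by (elim dvdE) (simp only: of_nat_mult of_nat_card_mod_ring mult_zero_left)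

lemma shifted_coeff_diff: "shifted_coeff (P - Q) c i = shifted_coeff P c i - shifted_coeff Q c i"
  by (simp add: shifted_coeff_def pcompose_diff)

lemma shifted_coeff_smult: "shifted_coeff (smult r P) c i = r * shifted_coeff P c i"
  by (simp add: shifted_coeff_def pcompose_smult)

lemma shifted_coeff_sum: "shifted_coeff (\<Sum>a\<in>A. f a) c i = (\<Sum>a\<in>A. shifted_coeff (f a) c i)"
  by (simp add: shifted_coeff_def pcompose_sum coeff_sum)

text \<open>
  Differentiation commutes with the substitution of \<open>t + c\<close> for t. Over a field of
  characteristic p the factor \<open>i + 1\<close> is what makes a derivative lose its coefficients
  of \<open>(t - c)\<^bsup>lp-1\<^esup>\<close>.
\<close>

lemma shifted_coeff_pderiv:
  "shifted_coeff (pderiv P) c i = of_nat (Suc i) * shifted_coeff P (c :: 'a::idom) (Suc i)"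
proof -
  have "pderiv (pcompose P [:c, 1:]) = pcompose (pderiv P) [:c, 1:]"
    by (simp add: pderiv_pcompose pderiv_pCons)
  then show ?thesis
    unfolding shifted_coeff_def by (metis coeff_pderiv)
qed

text \<open>
  Logarithmic differentiation in t: the factors depending only on z are constants. The product
  rule yields explicit cofactors of \<open>t - z\<^sub>a\<close> in \<open>\<Phi>\<close>; cancelling
  \<open>t - z\<^sub>a\<close> identifies them with the quotients \<open>\<Phi> / (t - z\<^sub>a)\<close>.
\<close>

lemma pderiv_master_poly:
  assumes "\<And>a. a \<in> {1..n} \<Longrightarrow> M a > 0"
  shows "pderiv (master_poly n M N) =
    (\<Sum>a\<in>{1..n}. smult (of_nat (M a)) (master_quot n M N a))"
proof -
  let ?L = "\<lambda>a. [:- Z a, 1:] :: int mpoly poly"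
  define r where "r = (\<Prod>a\<in>{1..n}. \<Prod>b\<in>{a<..n}. (Z a - Z b :: int mpoly) ^ N a b)"
  have quot: "smult r ((\<Prod>b\<in>{1..n} - {a}. ?L b ^ M b) * ?L a ^ (M a - 1)) = master_quot n M N a"
    if a: "a \<in> {1..n}" for a
  proof -
    have "?L a * smult r ((\<Prod>b\<in>{1..n} - {a}. ?L b ^ M b) * ?L a ^ (M a - 1)) =
        smult r (?L a ^ Suc (M a - 1) * (\<Prod>b\<in>{1..n} - {a}. ?L b ^ M b))"
      by (simp only: power_Suc mult_smult_right mult_ac)
    also have "\<dots> = smult r (\<Prod>b\<in>{1..n}. ?L b ^ M b)"
      using a assms[OF a] by (simp add: prod.remove[of _ a])
    also have "\<dots> = ?L a * master_quot n M N a"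
      using a assms[OF a] by (subst master_quot_eq) (simp_all add: master_poly_def r_def)
    finally show ?thesis by (subst (asm) mult_cancel_left) simp
  qed
  have "pderiv (master_poly n M N) = smult r (pderiv (\<Prod>a\<in>{1..n}. ?L a ^ M a))"
    by (simp add: master_poly_def r_def pderiv_smult)
  also have "\<dots> = (\<Sum>a\<in>{1..n}. smult r ((\<Prod>b\<in>{1..n} - {a}. ?L b ^ M b) *
      smult (of_nat (M a)) (?L a ^ (M a - 1))))"
    by (simp add: pderiv_prod pderiv_power pderiv_pCons smult_sum2)
  also have "\<dots> = (\<Sum>a\<in>{1..n}. smult (of_nat (M a)) (master_quot n M N a))"
    by (intro sum.cong refl) (simp add: mult.commute flip: quot)
  finally show ?thesis .
qed

text \<open>
  The right hand side is arranged so that only two integers have to be 0 modulo p: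
  \<open>1 + \<Sum>\<^sub>a M\<^sub>a\<close> here, and the factor \<open>i + 1\<close> that
  \<open>shifted_coeff_pderiv\<close> produces from the derivative.
\<close>

lemma sum_Z_master_quot:
  assumes "\<And>a. a \<in> {1..n} \<Longrightarrow> M a > 0"
  shows "(\<Sum>a\<in>{1..n}. smult (Z a * of_nat (M a)) (master_quot n M N a)) =
    pderiv ([:0, 1:] * master_poly n M N) -
    smult (of_nat (Suc (\<Sum>a\<in>{1..n}. M a))) (master_poly n M N)"
    (is "?lhs = pderiv (?t * ?\<Phi>) - _")
proof -
  let ?Q = "master_quot n M N"
  have "smult (Z a * of_nat (M a)) (?Q a) =
      ?t * smult (of_nat (M a)) (?Q a) - smult (of_nat (M a)) ?\<Phi>" if "a \<in> {1..n}" for a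
  proof -
    have "[:- Z a, 1:] = ?t - [:Z a:]" by simp
    then have "?\<Phi> = ?t * ?Q a - smult (Z a) (?Q a)"
      using master_quot_eq[of a n M N] that assms[OF that]
      by (simp add: left_diff_distrib del: mult_pCons_left) (simp add: left_diff_distrib)
    then show ?thesis
      by (simp add: smult_diff_right mult.commute del: mult_pCons_left)
  qed
  then have "?lhs = (\<Sum>a\<in>{1..n}. ?t * smult (of_nat (M a)) (?Q a) - smult (of_nat (M a)) ?\<Phi>)"
    by (intro sum.cong refl)
  also have "\<dots> = ?t * (\<Sum>a\<in>{1..n}. smult (of_nat (M a)) (?Q a)) -
      smult (of_nat (\<Sum>a\<in>{1..n}. M a)) ?\<Phi>"
    by (simp only: sum_subtractf sum_distrib_left of_nat_sum smult_sum)
  also have "(\<Sum>a\<in>{1..n}. smult (of_nat (M a)) (?Q a)) = pderiv ?\<Phi>"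
    using assms by (intro pderiv_master_poly[symmetric])
  finally show ?thesis
    by (simp add: pderiv_mult pderiv_pCons smult_add_left del: mult_pCons_left)
qed

theorem theorem1p7:
  fixes p n \<kappa> l :: nat and m M :: "nat \<Rightarrow> nat" and N :: "nat \<Rightarrow> nat \<Rightarrow> nat" and q :: int
    and I :: "nat \<Rightarrow> 'p::prime_card mod_ring mpoly"
  assumes "prime p" and "p > 2" and "CARD('p) = p"
    and "n \<ge> 1"
    and "\<kappa> > 0" and "\<not> p dvd \<kappa>"
    and "\<And>a. a \<in> {1..n} \<Longrightarrow> m a > 0"
    and "\<And>a. a \<in> {1..n} \<Longrightarrow> M a > 0"
    and "\<And>a b. 1 \<le> a \<Longrightarrow> a < b \<Longrightarrow> b \<le> n \<Longrightarrow> N a b > 0"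
    and "\<And>a. a \<in> {1..n} \<Longrightarrow>
           (of_nat (M a) :: 'p mod_ring) = - (of_nat (m a) / of_nat \<kappa>)"
    and "\<And>a b. 1 \<le> a \<Longrightarrow> a < b \<Longrightarrow> b \<le> n \<Longrightarrow>
           (of_nat (N a b) :: 'p mod_ring) = of_nat (m a) * of_nat (m b) / (2 * of_nat \<kappa>)"
    and "l > 0"
    and "\<And>a. a \<in> {1..n} \<Longrightarrow> I a = Ivec n M N q (l * p - 1) a"
    and "[(\<Sum>a\<in>{1..n}. int (M a)) = - 1] (mod int p)"
  shows "(\<Sum>a\<in>{1..n}. Z a * of_nat (M a) * I a) = 0"
proof -
  let ?\<Phi> = "master_poly n M N" and ?c = "of_int q :: int mpoly"
  let ?e = "Suc (\<Sum>a\<in>{1..n}. M a)"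
  \<comment> \<open>Here \<open>l > 0\<close> matters: the subtraction is truncated.\<close>
  have lp: "Suc (l * p - 1) = l * p"
    using assms(2,12) by (cases "l * p") auto
  have "int p dvd int ?e"
    using assms(14) by (simp add: cong_iff_dvd_diff add.commute)
  then have e: "CARD('p) dvd ?e"
    using assms(3) by (simp only: of_nat_dvd_iff)
  have "(\<Sum>a\<in>{1..n}. Z a * of_nat (M a) * I a) =
      reduce_mod (\<Sum>a\<in>{1..n}. Z a * of_nat (M a) * Ibar n M N q (l * p - 1) a)"
    using assms(13)
    by (simp add: Ivec_def reduce_mod_sum reduce_mod_mult reduce_mod_Z reduce_mod_of_nat)
  also have "(\<Sum>a\<in>{1..n}. Z a * of_nat (M a) * Ibar n M N q (l * p - 1) a) =
      shifted_coeff (\<Sum>a\<in>{1..n}. smult (Z a * of_nat (M a)) (master_quot n M N a)) ?c (l * p - 1)"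
    by (simp add: shifted_coeff_sum shifted_coeff_smult Ibar_def)
  also have "\<dots> = of_nat (l * p) * shifted_coeff ([:0, 1:] * ?\<Phi>) ?c (l * p) -
      of_nat ?e * shifted_coeff ?\<Phi> ?c (l * p - 1)"
    using assms(8)
    by (subst sum_Z_master_quot)
      (simp_all only: shifted_coeff_diff shifted_coeff_smult shifted_coeff_pderiv lp)
  also have "reduce_mod \<dots> = (0 :: 'p mod_ring mpoly)"
    using e assms(3)
    by (simp only: reduce_mod_diff reduce_mod_mult reduce_mod_of_nat_eq_0 dvd_triv_right) simp
  finally show ?thesis .
qed

end
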